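(* Let $S, A$ be nonempty finite sets and let $T \subseteq S \triangleright A$ be a set of policies that is closed under trajectory splicing. Let $\pi \in T$ be a policy that is $T$-optimal for a single success environment $\varepsilon \in A \triangleright (S\times G)$, and let $(\mathbf{a},\mathbf{s}) \in A^n\times S^n$ be a trajectory of length $n$. If the success-ambivalent evolution $\varepsilon' = \varepsilon\bullet(\mathbf{a}:\mathbf{s})$ and the evolution $\pi' = \pi\bullet(\mathbf{s}:\mathbf{a})$ are valid, then $\pi'$ is $T\bullet(\mathbf{s}:\mathbf{a})$-optimal for $\varepsilon'$.
   Context: For a finite set $X$, $P(X)$ is the set of probability distributions on $X$ and $\mathrm{supp}(p)$ is the support of $p\in P(X)$. For finite sets $I$ (inputs) and $O$ (outputs), the set $I \triangleright O$ of transducers is defined coinductively (it is the final coalgebra of $X \mapsto \sum_{p \in P(O)} (I \times \mathrm{supp}(p) \to X)$): a transducer $\pi$ is a pair $(\mathbb{P}_\pi, \mathbb{T}_\pi)$ with $\mathbb{P}_\pi \in P(O)$ and $\mathbb{T}_\pi : I \times \mathrm{supp}(\mathbb{P}_\pi) \to I \triangleright O$. Mixtures: for transducers $\pi_k$ and $\alpha_k\ge 0$ with $\sum_k\alpha_k=1$, the mixture $\sigma=\sum_k\alpha_k\pi_k$ is defined corecursively by $\mathbb{P}_\sigma=\sum_k\alpha_k\mathbb{P}_{\pi_k}$ and $\mathbb{T}_\sigma(i,o)=\sum_k \frac{\alpha_k\mathbb{P}_{\pi_k}(o)}{\sum_l\alpha_l\mathbb{P}_{\pi_l}(o)}\mathbb{T}_{\pi_k}(i,o)$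 for $o\in\mathrm{supp}(\mathbb{P}_\sigma)$ (again a mixture; terms with zero coefficient are omitted). Evolution: for strings $\mathbf{i}\in I^n$, $\mathbf{o}\in O^n$, $(\mathbf{i}:\mathbf{o})$ denotes the string of pairs $(\mathbf i_k,\mathbf o_k)$. Evolution by the empty string is $\pi$, and $\pi \bullet (\mathbf{i}\cdot i : \mathbf{o} \cdot o) = \mathbb{T}_{\pi \bullet (\mathbf{i}:\mathbf{o})}(i,o)$ if $\pi\bullet(\mathbf{i}:\mathbf{o})$ is defined and $o \in \mathrm{supp}(\mathbb{P}_{\pi\bullet(\mathbf{i}:\mathbf{o})})$; otherwise it is undefined. An evolution is valid if it is defined. For $T \subseteq I \triangleright O$, $T\bullet(\mathbf{i}:\mathbf{o}) = \{\pi'\bullet(\mathbf{i}:\mathbf{o}) : \pi' \in T,\ \text{the evolution is valid}\}$. Splicing: for $\pi,\pi' \in I \triangleright O$ and a trajectory valid for evolving $\pi$, $\pi \curlyvee_{(\mathbf{i}:\mathbf{o})} \pi'$ is defined inductively: along the empty trajectory it is $\pi'$; along $(i\cdot\mathbf{i} : o\cdot\mathbf{o})$ it is the transducer with output distribution $\mathbb{P}_\pi$ whose transition sends $(i,o)$ to $(\pi\bullet(i,o)) \curlyvee_{(\mathbf{i}:\mathbf{o})} \pi'$ and any other $(j,q)$ to $\pi\bullet(j,q)$. $T$ is closed under trajectory splicing if for all $\pi,\pi'\in T$ and every trajectory $(\mathbf{i}:\mathbf{o}) \in (I\times O)^*$ valid for evolving both, $\pi \curlyvee_{(\mathbf{i}:\mathbf{o})}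 (\pi'\bullet(\mathbf{i}:\mathbf{o})) \in T$. Let $G = \{\bot,\top\}$ ($\top$ = success). A policy is an element of $S\triangleright A$; a teleo-environment (environment) is an element of $A \triangleright (S\times G)$. An environment $\varepsilon$ is a single success environment if no trajectory $(\mathbf{a}:(\mathbf{s}:\mathbf{t}))$ for which there are two distinct indices $i\neq j$ with $\mathbf{t}_i=\mathbf{t}_j=\top$ is a valid evolution for $\varepsilon$. Success-ambivalent evolution of an environment: for $(a,s)\in A\times S$, with $q=\mathbb{P}_\varepsilon(s,\bot)+\mathbb{P}_\varepsilon(s,\top)$, it is valid if $q>0$, and then $\varepsilon\bullet(a,s)$ is the mixture $\frac{\mathbb{P}_\varepsilon(s,\bot)}{q}\mathbb{T}_\varepsilon(a,(s,\bot))+\frac{\mathbb{P}_\varepsilon(s,\top)}{q}\mathbb{T}_\varepsilon(a,(s,\top))$ (terms with zero coefficient omitted). For a trajectory, $\varepsilon\bullet(\mathbf{a}:\mathbf{s})$ is obtained by iterating this one pair at a time, and is valid if every step is. The success probability $\mathcal{S}(\pi,\varepsilon)$ is $\lim_{n\to\infty} \mathcal{S}_n(\pi,\varepsilon)$, where $\mathcal{S}_0(\pi,\varepsilon) = \sum_{s\in S} \mathbb{P}_\varepsilon(s,\top)$ and $\mathcal{S}_{n+1}(\pi,\varepsilon) = \sum_{s\in S}\sum_{a\in A} \left[\mathbb{P}_\pi(a)\mathbb{P}_\varepsilon(s,\top) + \mathbb{P}_\pi(a)\mathbb{P}_\varepsilon(s,\bot)\, \mathcal{S}_n\big(\mathbb{T}_\pi(s,a),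 \mathbb{T}_\varepsilon(a,(s,\bot))\big)\right]$ (terms with zero coefficient are omitted). For $T\subseteq S\triangleright A$, a policy $\pi\in T$ is $T$-optimal for $\varepsilon$ if $\mathcal{S}(\pi',\varepsilon)\le \mathcal{S}(\pi,\varepsilon)$ for all $\pi'\in T$. *)

theory Defs
  imports "HOL-Probability.Probability"
begin

text \<open>
  The transition map is partial: \<^term>\<open>None\<close> stands for ``not in the domain''. The
  codatatype alone does not tie that domain to the support of the output distribution;
  this is what the coinductive set \<open>transducers\<close> does. Its elements form the final coalgebra of
  \<open>X \<mapsto> (\<Sum>p. I \<times> supp p \<rightarrow> X)\<close>. Finite input and output sets are modelled by types of
  class \<^class>\<open>finite\<close>.
\<close>

codatatype ('i, 'o) transducer =
  Transducer (outp: "'o pmf") (transition: "'i \<Rightarrow> 'o \<Rightarrow> ('i, 'o) transducer option")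

coinductive_set transducers :: "('i, 'o) transducer set" where
  "\<lbrakk>\<And>i q. transition \<pi> i q \<noteq> None \<longleftrightarrow> q \<in> set_pmf (outp \<pi>);
    \<And>i q \<rho>. transition \<pi> i q = Some \<rho> \<Longrightarrow> \<rho> \<in> transducers\<rbrakk>
   \<Longrightarrow> \<pi> \<in> transducers"

lemma transition_eq_None_iff:
  "\<pi> \<in> transducers \<Longrightarrow> transition \<pi> i q = None \<longleftrightarrow> q \<notin> set_pmf (outp \<pi>)"
  by (erule transducers.cases) blast

lemma transition_in_transducers:
  assumes "\<pi> \<in> transducers" "q \<in> set_pmf (outp \<pi>)"
  shows "the (transition \<pi> i q) \<in> transducers"
proof -
  from assms obtain \<rho> where \<rho>: "transition \<pi> i q = Some \<rho>"
    using transition_eq_None_iff[of \<pi> i q] by auto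
  from assms(1) \<rho> have "\<rho> \<in> transducers"
    by (elim transducers.cases) blast
  with \<rho> show ?thesis by simp
qed


text \<open>
  A mixture \<open>\<Sum>k. \<alpha> k \<cdot> \<pi> k\<close> is given by the weights \<open>\<alpha>\<close>, as a distribution on a finite index
  type, and the family \<open>\<pi>\<close>. Members of weight zero influence neither the output
  distribution nor the new weights, so the value of \<^const>\<open>the\<close> at \<^term>\<open>None\<close> is harmless.
\<close>

definition posterior :: "'k::finite pmf \<Rightarrow> ('k \<Rightarrow> 'o pmf) \<Rightarrow> 'o \<Rightarrow> 'k pmf" where
  "posterior \<alpha> P q =
     embed_pmf (\<lambda>k. pmf \<alpha> k * pmf (P k) q / (\<Sum>l\<in>UNIV. pmf \<alpha> l * pmf (P l) q))"

primcorec mixture :: "'k::finite pmf \<Rightarrow> ('k \<Rightarrow> ('i, 'o) transducer) \<Rightarrow> ('i, 'o) transducer" where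
  "outp (mixture \<alpha> \<pi>) = bind_pmf \<alpha> (\<lambda>k. outp (\<pi> k))"
| "transition (mixture \<alpha> \<pi>) = (\<lambda>i q. map_option (\<lambda>(\<beta>, \<rho>). mixture \<beta> \<rho>)
     (if q \<in> set_pmf (bind_pmf \<alpha> (\<lambda>k. outp (\<pi> k)))
      then Some (posterior \<alpha> (\<lambda>k. outp (\<pi> k)) q, \<lambda>k. the (transition (\<pi> k) i q))
      else None))"

lemma pmf_bind_finite:
  fixes \<alpha> :: "'k::finite pmf"
  shows "pmf (bind_pmf \<alpha> P) q = (\<Sum>k\<in>UNIV. pmf \<alpha> k * pmf (P k) q)"
  by (simp add: pmf_bind integral_measure_pmf_real[of UNIV] mult.commute)

lemma pmf_posterior:
  fixes \<alpha> :: "'k::finite pmf"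
  assumes "q \<in> set_pmf (bind_pmf \<alpha> P)"
  shows "pmf (posterior \<alpha> P q) k =
           pmf \<alpha> k * pmf (P k) q / (\<Sum>l\<in>UNIV. pmf \<alpha> l * pmf (P l) q)"
proof -
  have "(\<Sum>l\<in>UNIV. pmf \<alpha> l * pmf (P l) q) > 0"
    using assms by (simp add: pmf_positive flip: pmf_bind_finite)
  then show ?thesis
    unfolding posterior_def
    by (intro pmf_embed_pmf)
       (auto simp: nn_integral_count_space_finite sum_nonneg simp flip: sum_divide_distrib
             intro!: divide_nonneg_nonneg)
qed

lemma mixture_in_transducers:
  assumes "\<And>k. k \<in> set_pmf \<alpha> \<Longrightarrow> \<pi> k \<in> transducers"
  shows "mixture \<alpha> \<pi> \<in> transducers"
  using assms
proof (coinduction arbitrary: \<alpha> \<pi> rule: transducers.coinduct)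
  case transducers
  then have in_transducers: "\<pi> k \<in> transducers" if "k \<in> set_pmf \<alpha>" for k
    using that by blast
  have "the (transition (\<pi> k) i q) \<in> transducers"
    if q: "q \<in> set_pmf (bind_pmf \<alpha> (\<lambda>k. outp (\<pi> k)))"
      and k: "k \<in> set_pmf (posterior \<alpha> (\<lambda>k. outp (\<pi> k)) q)" for k i q
  proof -
    from k have "k \<in> set_pmf \<alpha>" "q \<in> set_pmf (outp (\<pi> k))"
      by (auto simp: set_pmf_iff pmf_posterior[OF q])
    then show ?thesis
      by (intro transition_in_transducers in_transducers)
  qed
  then show ?case
    by (fastforce simp: split: if_splits)
qed


text \<open>
  Trajectories are lists of input-output pairs; an evolution is valid iff it is not
  \<^term>\<open>None\<close>.
\<close>

definition evolve :: "('i, 'o) transducer \<Rightarrow> ('i \<times> 'o) list \<Rightarrow> ('i, 'o) transducer option" where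
  "evolve \<pi> xs = foldl (\<lambda>r (i, q). Option.bind r (\<lambda>\<rho>. transition \<rho> i q)) (Some \<pi>) xs"

definition evolve_set :: "('i, 'o) transducer set \<Rightarrow> ('i \<times> 'o) list \<Rightarrow> ('i, 'o) transducer set" where
  "evolve_set T xs = {\<rho>. \<exists>\<pi>\<in>T. evolve \<pi> xs = Some \<rho>}"

primrec splice_along ::
  "('i, 'o) transducer \<Rightarrow> ('i \<times> 'o) list \<Rightarrow> ('i, 'o) transducer \<Rightarrow> ('i, 'o) transducer" where
  "splice_along \<pi> [] \<pi>' = \<pi>'"
| "splice_along \<pi> (x # xs) \<pi>' =
     Transducer (outp \<pi>)
       (\<lambda>j r. if (j, r) = x then map_option (\<lambda>\<rho>. splice_along \<rho> xs \<pi>') (transition \<pi> j r)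
              else transition \<pi> j r)"

definition splicing_closed :: "('i, 'o) transducer set \<Rightarrow> bool" where
  "splicing_closed T \<longleftrightarrow>
     (\<forall>\<pi>\<in>T. \<forall>\<pi>'\<in>T. \<forall>xs. evolve \<pi> xs \<noteq> None \<and> evolve \<pi>' xs \<noteq> None \<longrightarrow>
        splice_along \<pi> xs (the (evolve \<pi>' xs)) \<in> T)"


text \<open>The set \<open>G\<close> is \<^typ>\<open>bool\<close>, with \<^term>\<open>True\<close> for success.\<close>

type_synonym ('s, 'a) policy = "('s, 'a) transducer"
type_synonym ('a, 's) environment = "('a, 's \<times> bool) transducer"

definition single_success :: "('a, 's) environment \<Rightarrow> bool" where
  "single_success \<epsilon> \<longleftrightarrow>
     (\<forall>xs. (\<exists>i<length xs. \<exists>j<length xs. i \<noteq> j \<and> snd (snd (xs ! i)) \<and> snd (snd (xs ! j)))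
           \<longrightarrow> evolve \<epsilon> xs = None)"

definition ambivalent_step :: "('a, 's) environment \<Rightarrow> 'a \<Rightarrow> 's \<Rightarrow> ('a, 's) environment option" where
  "ambivalent_step \<epsilon> a s =
     (let q = pmf (outp \<epsilon>) (s, False) + pmf (outp \<epsilon>) (s, True) in
      if q > 0
      then Some (mixture (bernoulli_pmf (pmf (outp \<epsilon>) (s, True) / q))
                         (\<lambda>g. the (transition \<epsilon> a (s, g))))
      else None)"

definition ambivalent_evolve ::
  "('a, 's) environment \<Rightarrow> ('a \<times> 's) list \<Rightarrow> ('a, 's) environment option" where
  "ambivalent_evolve \<epsilon> xs =
     foldl (\<lambda>r (a, s). Option.bind r (\<lambda>\<rho>. ambivalent_step \<rho> a s)) (Some \<epsilon>) xs"

primrec success_upto ::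
  "nat \<Rightarrow> ('s::finite, 'a::finite) policy \<Rightarrow> ('a, 's) environment \<Rightarrow> real" where
  "success_upto 0 \<pi> \<epsilon> = (\<Sum>s\<in>UNIV. pmf (outp \<epsilon>) (s, True))"
| "success_upto (Suc n) \<pi> \<epsilon> =
     (\<Sum>s\<in>UNIV. \<Sum>a\<in>UNIV.
        pmf (outp \<pi>) a * pmf (outp \<epsilon>) (s, True) +
        pmf (outp \<pi>) a * pmf (outp \<epsilon>) (s, False) *
          success_upto n (the (transition \<pi> s a)) (the (transition \<epsilon> a (s, False))))"

lemma sum_pmf_success:
  fixes p :: "('s::finite \<times> bool) pmf"
  shows "(\<Sum>s\<in>UNIV. pmf p (s, True) + pmf p (s, False)) = 1"
proof -
  have "(\<Sum>s\<in>UNIV. pmf p (s, True) + pmf p (s, False)) = (\<Sum>s\<in>UNIV. \<Sum>g\<in>UNIV. pmf p (s, g))"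
    by (simp add: UNIV_bool add.commute)
  also have "\<dots> = (\<Sum>x\<in>UNIV. pmf p x)"
    by (simp add: sum.cartesian_product)
  also have "\<dots> = 1"
    by (simp add: sum_pmf_eq_1)
  finally show ?thesis .
qed

lemma success_upto_step:
  fixes \<pi> :: "('s::finite, 'a::finite) policy" and \<epsilon> :: "('a, 's) environment"
  assumes "\<pi> \<in> transducers" "\<epsilon> \<in> transducers"
  shows "0 \<le> success_upto n \<pi> \<epsilon> \<and> success_upto n \<pi> \<epsilon> \<le> 1 \<and>
         success_upto n \<pi> \<epsilon> \<le> success_upto (Suc n) \<pi> \<epsilon>"
  using assms
proof (induction n arbitrary: \<pi> \<epsilon>)
  case (0 \<pi> \<epsilon>)
  have total_a: "(\<Sum>a\<in>UNIV. pmf (outp \<pi>) a) = 1"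
    by (simp add: sum_pmf_eq_1)
  have "success_upto 0 \<pi> \<epsilon> \<le>
      (\<Sum>s\<in>UNIV. pmf (outp \<epsilon>) (s, True) + pmf (outp \<epsilon>) (s, False))"
    by (simp add: sum_mono)
  then have "success_upto 0 \<pi> \<epsilon> \<le> 1"
    by (simp only: sum_pmf_success)
  moreover have "success_upto 0 \<pi> \<epsilon> \<ge> 0"
    by (simp add: sum_nonneg)
  moreover have "success_upto 0 \<pi> \<epsilon> \<le> success_upto (Suc 0) \<pi> \<epsilon>"
  proof -
    have "success_upto 0 \<pi> \<epsilon> =
        (\<Sum>s\<in>UNIV. \<Sum>a\<in>UNIV. pmf (outp \<pi>) a * pmf (outp \<epsilon>) (s, True))"
      by (simp add: total_a flip: sum_distrib_right)
    also have "\<dots> \<le> success_upto (Suc 0) \<pi> \<epsilon>"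
      unfolding success_upto.simps by (intro sum_mono) (simp add: sum_nonneg)
    finally show ?thesis .
  qed
  ultimately show ?case by blast
next
  case (Suc n \<pi> \<epsilon>)
  define w where "w = (\<lambda>s a. pmf (outp \<pi>) a * pmf (outp \<epsilon>) (s, False))"
  define v where "v = (\<lambda>m s a. success_upto m (the (transition \<pi> s a)) (the (transition \<epsilon> a (s, False))))"
  define u where "u = (\<lambda>(s::'s) a. pmf (outp \<pi>) a * pmf (outp \<epsilon>) (s, True))"
  have unfold: "success_upto (Suc m) \<pi> \<epsilon> = (\<Sum>s\<in>UNIV. \<Sum>a\<in>UNIV. u s a + w s a * v m s a)" for m
    by (simp add: u_def w_def v_def)
  have IH: "0 \<le> w s a * v n s a" "w s a * v n s a \<le> w s a" "w s a * v n s a \<le> w s a * v (Suc n) s a"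
    for s a
  proof -
    have "0 \<le> v n s a \<and> v n s a \<le> 1 \<and> v n s a \<le> v (Suc n) s a" if "w s a \<noteq> 0"
      unfolding v_def using that Suc.prems
      by (intro Suc.IH transition_in_transducers) (simp_all add: w_def set_pmf_iff)
    moreover have "w s a \<ge> 0" by (simp add: w_def)
    ultimately have "0 \<le> w s a * v n s a \<and> w s a * v n s a \<le> w s a \<and>
        w s a * v n s a \<le> w s a * v (Suc n) s a"
      by (cases "w s a = 0") (auto intro: mult_nonneg_nonneg mult_left_le mult_left_mono)
    then show "0 \<le> w s a * v n s a" "w s a * v n s a \<le> w s a"
        "w s a * v n s a \<le> w s a * v (Suc n) s a"
      by blast+
  qed
  have "success_upto (Suc n) \<pi> \<epsilon> \<le> (\<Sum>s\<in>UNIV. \<Sum>a\<in>UNIV. u s a + w s a)"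
    unfolding unfold using IH(2) by (intro sum_mono add_left_mono)
  also have "\<dots> = (\<Sum>s\<in>UNIV. \<Sum>a\<in>UNIV.
      pmf (outp \<pi>) a * (pmf (outp \<epsilon>) (s, True) + pmf (outp \<epsilon>) (s, False)))"
    by (simp add: u_def w_def distrib_left)
  also have "\<dots> = (\<Sum>s\<in>UNIV. pmf (outp \<epsilon>) (s, True) + pmf (outp \<epsilon>) (s, False))"
    by (simp add: sum_pmf_eq_1 flip: sum_distrib_right)
  also have "\<dots> = 1"
    by (rule sum_pmf_success)
  finally have "success_upto (Suc n) \<pi> \<epsilon> \<le> 1" .
  moreover have "0 \<le> success_upto (Suc n) \<pi> \<epsilon>"
    unfolding unfold using IH(1) by (intro sum_nonneg add_nonneg_nonneg) (simp_all add: u_def)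
  moreover have "success_upto (Suc n) \<pi> \<epsilon> \<le> success_upto (Suc (Suc n)) \<pi> \<epsilon>"
    unfolding unfold using IH(3) by (intro sum_mono add_left_mono)
  ultimately show ?case by blast
qed

lemma convergent_success_upto:
  assumes "\<pi> \<in> transducers" "\<epsilon> \<in> transducers"
  shows "convergent (\<lambda>n. success_upto n \<pi> \<epsilon>)"
proof -
  note step = success_upto_step[OF assms]
  have "incseq (\<lambda>n. success_upto n \<pi> \<epsilon>)"
    by (rule incseq_SucI) (use step in blast)
  moreover have "\<forall>n. success_upto n \<pi> \<epsilon> \<le> 1"
    using step by blast
  ultimately obtain L where "(\<lambda>n. success_upto n \<pi> \<epsilon>) \<longlonglongrightarrow> L"
    by (rule incseq_convergent)
  then show ?thesis
    by (rule convergentI)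
qed

definition success :: "('s::finite, 'a::finite) policy \<Rightarrow> ('a, 's) environment \<Rightarrow> real" where
  "success \<pi> \<epsilon> = lim (\<lambda>n. success_upto n \<pi> \<epsilon>)"

definition optimal_for ::
  "('s::finite, 'a::finite) policy set \<Rightarrow> ('s, 'a) policy \<Rightarrow> ('a, 's) environment \<Rightarrow> bool" where
  "optimal_for T \<pi> \<epsilon> \<longleftrightarrow> \<pi> \<in> T \<and> (\<forall>\<pi>'\<in>T. success \<pi>' \<epsilon> \<le> success \<pi> \<epsilon>)"

end

(*
  Induction along the trajectory reduces the claim to one pair (a, s), because the hypotheses survive
  a step. For one step, splicing a competitor into the optimal policy at (s, a) changes only the
  summand of the success probability that belongs to (s, a) and to no success so far. Hence the
  evolved policy is optimal for the failure branch of the environment. The success probability is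
  affine in mixtures of environments, and the success branch contributes 0 since a single success
  environment cannot succeed twice; so the success probabilities for the ambivalent evolution are
  those for the failure branch times a constant weight.
*)

theory Submission
  imports Defs
begin

section \<open>Evolution\<close>

lemma evolve_Nil [simp]: "evolve \<pi> [] = Some \<pi>"
  by (simp add: evolve_def)

text \<open>\<open>None\<close> is absorbing for the fold, so the first pair can be split off;
  inductions along trajectories use this form, with the starting transducer varying.\<close>

lemma evolve_Cons:
  "evolve \<pi> ((i, q) # xs) = Option.bind (transition \<pi> i q) (\<lambda>\<rho>. evolve \<rho> xs)"
proof -
  have "foldl (\<lambda>r (i, q). Option.bind r (\<lambda>\<rho>. transition \<rho> i q)) None ys = None"
    for ys :: "('a \<times> 'b) list"
    by (induction ys) auto
  then show ?thesis
    by (cases "transition \<pi> i q") (simp_all add: evolve_def)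
qed

lemma evolve_Cons_eq_Some_iff:
  "evolve \<pi> ((i, q) # xs) = Some \<rho> \<longleftrightarrow> (\<exists>\<sigma>. transition \<pi> i q = Some \<sigma> \<and> evolve \<sigma> xs = Some \<rho>)"
  by (auto simp: evolve_Cons bind_eq_Some_conv)

lemma ambivalent_evolve_Nil [simp]: "ambivalent_evolve \<epsilon> [] = Some \<epsilon>"
  by (simp add: ambivalent_evolve_def)

lemma ambivalent_evolve_Cons:
  "ambivalent_evolve \<epsilon> ((a, s) # xs) =
     Option.bind (ambivalent_step \<epsilon> a s) (\<lambda>\<rho>. ambivalent_evolve \<rho> xs)"
proof -
  have "foldl (\<lambda>r (a, s). Option.bind r (\<lambda>\<rho>. ambivalent_step \<rho> a s)) None ys = None"
    for ys :: "('a \<times> 'b) list"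
    by (induction ys) auto
  then show ?thesis
    by (cases "ambivalent_step \<epsilon> a s") (simp_all add: ambivalent_evolve_def)
qed

lemma evolve_set_Nil [simp]: "evolve_set T [] = T"
  by (auto simp: evolve_set_def)

lemma evolve_set_Cons: "evolve_set T (x # xs) = evolve_set (evolve_set T [x]) xs"
  by (cases x) (auto simp: evolve_set_def evolve_Cons_eq_Some_iff)

lemma transition_Some_in_transducers:
  assumes "\<pi> \<in> transducers" "transition \<pi> i q = Some \<rho>"
  shows "\<rho> \<in> transducers"
  using assms by (elim transducers.cases) blast

lemma transition_eq_Some_the:
  assumes "\<pi> \<in> transducers" "q \<in> set_pmf (outp \<pi>)"
  shows "transition \<pi> i q = Some (the (transition \<pi> i q))"
  using assms transition_eq_None_iff[of \<pi> i q] by auto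

section \<open>Hypotheses on the policy set after one step\<close>

lemma evolve_set_single_subset_transducers:
  assumes "T \<subseteq> transducers"
  shows "evolve_set T [(i, q)] \<subseteq> transducers"
  using assms transition_Some_in_transducers
  by (fastforce simp: evolve_set_def evolve_Cons_eq_Some_iff)

text \<open>Prepend \<open>(i, q)\<close> to the trajectory: the predecessors in \<open>T\<close>
  are spliced along the longer trajectory inside \<open>T\<close>, and evolving the result by
  \<open>(i, q)\<close> leaves the splice of their successors.\<close>

lemma splicing_closed_evolve_set_single:
  assumes "splicing_closed T"
  shows "splicing_closed (evolve_set T [(i, q)])"
  unfolding splicing_closed_def
proof (intro ballI allI impI)
  fix \<rho> \<rho>' xs
  assume "\<rho> \<in> evolve_set T [(i, q)]" "\<rho>' \<in> evolve_set T [(i, q)]"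
    and valid: "evolve \<rho> xs \<noteq> None \<and> evolve \<rho>' xs \<noteq> None"
  then obtain \<pi> \<pi>' where
    T: "\<pi> \<in> T" "\<pi>' \<in> T" and tr: "transition \<pi> i q = Some \<rho>" "transition \<pi>' i q = Some \<rho>'"
    by (auto simp: evolve_set_def evolve_Cons_eq_Some_iff)
  from tr have "evolve \<pi> ((i, q) # xs) = evolve \<rho> xs" "evolve \<pi>' ((i, q) # xs) = evolve \<rho>' xs"
    by (simp_all add: evolve_Cons)
  with T valid assms have "splice_along \<pi> ((i, q) # xs) (the (evolve \<rho>' xs)) \<in> T"
    unfolding splicing_closed_def by metis
  moreover have "evolve (splice_along \<pi> ((i, q) # xs) \<sigma>) [(i, q)] = Some (splice_along \<rho> xs \<sigma>)" for \<sigma>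
    using tr by (simp add: evolve_Cons)
  ultimately show "splice_along \<rho> xs (the (evolve \<rho>' xs)) \<in> evolve_set T [(i, q)]"
    unfolding evolve_set_def by blast
qed


section \<open>Mixtures\<close>

lemma transition_mixture:
  assumes "q \<in> set_pmf (bind_pmf \<alpha> (\<lambda>k. outp (\<pi> k)))"
  shows "transition (mixture \<alpha> \<pi>) i q =
    Some (mixture (posterior \<alpha> (\<lambda>k. outp (\<pi> k)) q) (\<lambda>k. the (transition (\<pi> k) i q)))"
  using assms by simp

text \<open>For components in \<open>transducers\<close>, this ensures that those keeping positive
  weight after the output \<open>q\<close> have a defined transition at \<open>q\<close>, so
  \<open>the\<close> is harmless there.\<close>

lemma set_pmf_posterior:
  assumes "q \<in> set_pmf (bind_pmf \<alpha> P)"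
  shows "set_pmf (posterior \<alpha> P q) \<subseteq> {k \<in> set_pmf \<alpha>. q \<in> set_pmf (P k)}"
  by (auto simp: set_pmf_iff pmf_posterior[OF assms])

text \<open>Each step yields a mixture over those components that can produce the observed output. A
  component of positive weight at the end has therefore followed the whole trajectory
  itself.\<close>

lemma evolve_mixture_valid:
  assumes "\<And>k. k \<in> set_pmf \<alpha> \<Longrightarrow> \<pi> k \<in> transducers"
    and "evolve (mixture \<alpha> \<pi>) xs \<noteq> None"
  shows "\<exists>k\<in>set_pmf \<alpha>. evolve (\<pi> k) xs \<noteq> None"
  using assms
proof (induction xs arbitrary: \<alpha> \<pi>)
  case Nil
  then show ?case
    using set_pmf_not_empty[of \<alpha>] by auto
next
  case (Cons x xs)
  obtain i q where x: "x = (i, q)" by fastforce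
  have q: "q \<in> set_pmf (bind_pmf \<alpha> (\<lambda>k. outp (\<pi> k)))"
    using Cons.prems(2) by (auto simp: x evolve_Cons simp del: set_bind_pmf split: if_splits)
  note post = set_pmf_posterior[OF q]
  have "the (transition (\<pi> k) i q) \<in> transducers"
    if "k \<in> set_pmf (posterior \<alpha> (\<lambda>k. outp (\<pi> k)) q)" for k
    using that post Cons.prems(1) by (intro transition_in_transducers) auto
  moreover have "evolve (mixture (posterior \<alpha> (\<lambda>k. outp (\<pi> k)) q)
                           (\<lambda>k. the (transition (\<pi> k) i q))) xs \<noteq> None"
    using Cons.prems(2) unfolding x evolve_Cons transition_mixture[OF q] by simp
  ultimately obtain k where k: "k \<in> set_pmf (posterior \<alpha> (\<lambda>k. outp (\<pi> k)) q)"
    "evolve (the (transition (\<pi> k) i q)) xs \<noteq> None"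
    using Cons.IH[of "posterior \<alpha> (\<lambda>k. outp (\<pi> k)) q" "\<lambda>k. the (transition (\<pi> k) i q)"]
    by blast
  then have "k \<in> set_pmf \<alpha>" and "q \<in> set_pmf (outp (\<pi> k))"
    using post by auto
  moreover from this have "evolve (\<pi> k) (x # xs) \<noteq> None"
    using k(2) transition_eq_Some_the[OF Cons.prems(1), of k q i]
    unfolding x evolve_Cons by (metis Option.bind.bind_lunit)
  ultimately show ?case by blast
qed

text \<open>A trajectory with two successes that is valid for the mixture would be valid for some
  component of positive weight.\<close>

lemma single_success_mixture:
  assumes "\<And>k. k \<in> set_pmf \<alpha> \<Longrightarrow> \<epsilon> k \<in> transducers"
    and "\<And>k. k \<in> set_pmf \<alpha> \<Longrightarrow> single_success (\<epsilon> k)"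
  shows "single_success (mixture \<alpha> \<epsilon>)"
  unfolding single_success_def
proof (intro allI impI, rule ccontr)
  fix xs
  assume two: "\<exists>i<length xs. \<exists>j<length xs. i \<noteq> j \<and> snd (snd (xs ! i)) \<and> snd (snd (xs ! j))"
    and valid: "evolve (mixture \<alpha> \<epsilon>) xs \<noteq> None"
  have "\<exists>k\<in>set_pmf \<alpha>. evolve (\<epsilon> k) xs \<noteq> None"
    using valid by (rule evolve_mixture_valid[rotated]) (rule assms(1))
  then obtain k where k: "k \<in> set_pmf \<alpha>" "evolve (\<epsilon> k) xs \<noteq> None"
    by blast
  have "evolve (\<epsilon> k) xs = None"
    using assms(2)[OF k(1), unfolded single_success_def, THEN spec, of xs] two by (rule mp)
  with k(2) show False
    by contradiction
qed

text \<open>This is Bayes' rule: the probability of an output under the mixture times the posterior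
  weight of \<open>k\<close> equals the prior weight of \<open>k\<close> times the probability of
  that output under \<open>k\<close>.\<close>

lemma success_upto_mixture:
  fixes \<pi> :: "('b::finite, 'a::finite) policy"
    and \<alpha> :: "'c::finite pmf" and \<epsilon> :: "'c \<Rightarrow> ('a, 'b) environment"
  shows "success_upto n \<pi> (mixture \<alpha> \<epsilon>) = (\<Sum>k\<in>UNIV. pmf \<alpha> k * success_upto n \<pi> (\<epsilon> k))"
proof (induction n arbitrary: \<pi> \<alpha> \<epsilon>)
  case 0
  show ?case
    by (simp add: pmf_bind_finite sum_distrib_left) (rule sum.swap)
next
  case (Suc n)
  let ?w = "\<lambda>k s. pmf \<alpha> k * pmf (outp (\<epsilon> k)) (s, False)"
  let ?S = "\<lambda>k s a. success_upto n (the (transition \<pi> s a)) (the (transition (\<epsilon> k) a (s, False)))"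
  \<comment> \<open>The leading sum is the normalising constant of the posterior and cancels against
    it. If it is zero, the posterior has no meaning, but every term on both sides vanishes.\<close>
  have failure: "(\<Sum>k\<in>UNIV. ?w k s) *
      success_upto n (the (transition \<pi> s a)) (the (transition (mixture \<alpha> \<epsilon>) a (s, False)))
      = (\<Sum>k\<in>UNIV. ?w k s * ?S k s a)" for s a
  proof (cases "(\<Sum>k\<in>UNIV. ?w k s) = 0")
    case True
    then have "?w k s = 0" for k
      by (simp add: sum_nonneg_eq_0_iff)
    then have "?w k s * ?S k s a = 0" for k
      by (metis mult_zero_left)
    then have "(\<Sum>k\<in>UNIV. ?w k s * ?S k s a) = 0"
      by (intro sum.neutral) blast
    with True show ?thesis by simp
  next
    case False
    then have q: "(s, False) \<in> set_pmf (bind_pmf \<alpha> (\<lambda>k. outp (\<epsilon> k)))"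
      by (simp add: set_pmf_iff pmf_bind_finite del: set_bind_pmf)
    show ?thesis
      using False
      by (simp only: transition_mixture[OF q] option.sel Suc.IH pmf_posterior[OF q] sum_distrib_left)
         (simp add: field_simps)
  qed
  have "success_upto (Suc n) \<pi> (mixture \<alpha> \<epsilon>) = (\<Sum>s\<in>UNIV. \<Sum>a\<in>UNIV. \<Sum>k\<in>UNIV.
      pmf \<alpha> k * (pmf (outp \<pi>) a * pmf (outp (\<epsilon> k)) (s, True) +
        pmf (outp \<pi>) a * pmf (outp (\<epsilon> k)) (s, False) * ?S k s a))"
    unfolding success_upto.simps mixture.sel(1) pmf_bind_finite mult.assoc failure
    by (simp add: sum_distrib_left distrib_left sum.distrib mult_ac)
  also have "\<dots> = (\<Sum>k\<in>UNIV. \<Sum>s\<in>UNIV. \<Sum>a\<in>UNIV.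
      pmf \<alpha> k * (pmf (outp \<pi>) a * pmf (outp (\<epsilon> k)) (s, True) +
        pmf (outp \<pi>) a * pmf (outp (\<epsilon> k)) (s, False) * ?S k s a))"
    by (simp only: sum.swap[where A = "UNIV :: 'a set" and B = "UNIV :: 'c set"]
                   sum.swap[where A = "UNIV :: 'b set" and B = "UNIV :: 'c set"])
  finally show ?case
    by (simp add: sum_distrib_left)
qed


section \<open>Success probability\<close>

lemma success_upto_tendsto:
  assumes "\<pi> \<in> transducers" "\<epsilon> \<in> transducers"
  shows "(\<lambda>n. success_upto n \<pi> \<epsilon>) \<longlonglongrightarrow> success \<pi> \<epsilon>"
  using convergent_success_upto[OF assms] unfolding success_def by (simp add: convergent_LIMSEQ_iff)

text \<open>The recursion for \<open>success_upto\<close> passes to the limit term by term, since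
  the sums are finite.\<close>

lemma success_eq:
  assumes "\<pi> \<in> transducers" "\<epsilon> \<in> transducers"
  shows "success \<pi> \<epsilon> = (\<Sum>s\<in>UNIV. \<Sum>a\<in>UNIV.
        pmf (outp \<pi>) a * pmf (outp \<epsilon>) (s, True) +
        pmf (outp \<pi>) a * pmf (outp \<epsilon>) (s, False) *
          success (the (transition \<pi> s a)) (the (transition \<epsilon> a (s, False))))"
    (is "_ = ?R")
proof (rule LIMSEQ_unique)
  show "(\<lambda>n. success_upto (Suc n) \<pi> \<epsilon>) \<longlonglongrightarrow> success \<pi> \<epsilon>"
    using success_upto_tendsto[OF assms] by (rule LIMSEQ_Suc)
  have "(\<lambda>n. pmf (outp \<pi>) a * pmf (outp \<epsilon>) (s, False) *
            success_upto n (the (transition \<pi> s a)) (the (transition \<epsilon> a (s, False))))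
        \<longlonglongrightarrow> pmf (outp \<pi>) a * pmf (outp \<epsilon>) (s, False) *
            success (the (transition \<pi> s a)) (the (transition \<epsilon> a (s, False)))" for s a
  proof (cases "pmf (outp \<pi>) a * pmf (outp \<epsilon>) (s, False) = 0")
    case True
    then show ?thesis
      by (simp only: mult_zero_left tendsto_const)
  next
    case False
    then show ?thesis
      using assms
      by (intro tendsto_mult_left success_upto_tendsto transition_in_transducers)
         (auto simp: set_pmf_iff)
  qed
  then show "(\<lambda>n. success_upto (Suc n) \<pi> \<epsilon>) \<longlonglongrightarrow> ?R"
    unfolding success_upto.simps by (intro tendsto_sum tendsto_add tendsto_const)
qed

lemma success_mixture:
  assumes "\<pi> \<in> transducers" "\<And>k. k \<in> set_pmf \<alpha> \<Longrightarrow> \<epsilon> k \<in> transducers"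
  shows "success \<pi> (mixture \<alpha> \<epsilon>) = (\<Sum>k\<in>UNIV. pmf \<alpha> k * success \<pi> (\<epsilon> k))"
proof (rule LIMSEQ_unique)
  show "(\<lambda>n. success_upto n \<pi> (mixture \<alpha> \<epsilon>)) \<longlonglongrightarrow> success \<pi> (mixture \<alpha> \<epsilon>)"
    using assms by (intro success_upto_tendsto mixture_in_transducers)
  have "(\<lambda>n. pmf \<alpha> k * success_upto n \<pi> (\<epsilon> k)) \<longlonglongrightarrow> pmf \<alpha> k * success \<pi> (\<epsilon> k)" for k
    using assms
    by (cases "k \<in> set_pmf \<alpha>") (auto simp: set_pmf_iff intro!: tendsto_mult_left success_upto_tendsto)
  then show "(\<lambda>n. success_upto n \<pi> (mixture \<alpha> \<epsilon>)) \<longlonglongrightarrow> (\<Sum>k\<in>UNIV. pmf \<alpha> k * success \<pi> (\<epsilon> k))"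
    unfolding success_upto_mixture by (intro tendsto_sum)
qed

section \<open>Environments after their only success\<close>

definition never_success :: "('a, 's) environment \<Rightarrow> bool" where
  "never_success \<epsilon> \<longleftrightarrow> (\<forall>xs. evolve \<epsilon> xs \<noteq> None \<longrightarrow> (\<forall>x\<in>set xs. \<not> snd (snd x)))"

lemma never_success_transition:
  assumes "never_success \<epsilon>" "transition \<epsilon> a x = Some \<epsilon>'"
  shows "never_success \<epsilon>'"
  unfolding never_success_def
proof (intro allI impI)
  fix xs
  assume "evolve \<epsilon>' xs \<noteq> None"
  then have "evolve \<epsilon> ((a, x) # xs) \<noteq> None"
    using assms(2) by (simp add: evolve_Cons)
  then show "\<forall>x\<in>set xs. \<not> snd (snd x)"
    using assms(1) unfolding never_success_def by (metis list.set_intros(2))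
qed

lemma pmf_never_success:
  assumes "never_success \<epsilon>" "\<epsilon> \<in> transducers"
  shows "pmf (outp \<epsilon>) (s, True) = 0"
proof (rule ccontr)
  assume "pmf (outp \<epsilon>) (s, True) \<noteq> 0"
  then have "transition \<epsilon> a (s, True) \<noteq> None" for a
    using transition_eq_None_iff[OF assms(2)] by (auto simp: set_pmf_iff)
  \<comment> \<open>Any action serves here, because the output distribution of \<epsilon> does not
    depend on the action that is read with the output.\<close>
  then have "evolve \<epsilon> [(undefined, (s, True))] \<noteq> None"
    by (auto simp: evolve_Cons)
  then show False
    using assms(1) unfolding never_success_def by fastforce
qed

text \<open>The immediate success terms have probability zero, and each failure branch that can be
  reached again admits no success.\<close>

lemma success_upto_never_success:
  assumes "never_success \<epsilon>" "\<epsilon> \<in> transducers"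
  shows "success_upto n \<pi> \<epsilon> = 0"
  using assms
proof (induction n arbitrary: \<pi> \<epsilon>)
  case (Suc n)
  have "pmf (outp \<epsilon>) (s, False) *
      success_upto n (the (transition \<pi> s a)) (the (transition \<epsilon> a (s, False))) = 0" for s a
  proof (cases "(s, False) \<in> set_pmf (outp \<epsilon>)")
    case True
    then have "the (transition \<epsilon> a (s, False)) \<in> transducers"
      and "never_success (the (transition \<epsilon> a (s, False)))"
      using transition_in_transducers[OF Suc.prems(2) True]
        never_success_transition[OF Suc.prems(1) transition_eq_Some_the[OF Suc.prems(2) True]]
      by blast+
    then show ?thesis
      by (simp add: Suc.IH)
  qed (simp add: set_pmf_iff)
  then show ?case
    using pmf_never_success[OF Suc.prems]
    by (simp only: success_upto.simps mult.assoc mult_zero_right add_0_left sum.neutral_const)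
qed (simp add: pmf_never_success)

lemma success_never_success:
  assumes "never_success \<epsilon>" "\<epsilon> \<in> transducers"
  shows "success \<pi> \<epsilon> = 0"
  using assms by (simp add: success_def success_upto_never_success)

text \<open>Prepending \<open>(a, x)\<close> shifts all indices by one, so two successes of a
  continuation stay at distinct indices.\<close>

lemma single_success_transition:
  fixes \<epsilon> :: "('a, 's) environment"
  assumes "single_success \<epsilon>" "transition \<epsilon> a x = Some \<epsilon>'"
  shows "single_success \<epsilon>'"
  unfolding single_success_def
proof (intro allI impI)
  fix xs :: "('a \<times> 's \<times> bool) list"
  let ?xs = "(a, x) # xs"
  assume "\<exists>i<length xs. \<exists>j<length xs. i \<noteq> j \<and> snd (snd (xs ! i)) \<and> snd (snd (xs ! j))"
  then obtain i j where "i < length xs" "j < length xs" "i \<noteq> j"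
    "snd (snd (xs ! i))" "snd (snd (xs ! j))"
    by blast
  then have "Suc i < length ?xs" "Suc j < length ?xs" "Suc i \<noteq> Suc j"
    "snd (snd (?xs ! Suc i))" "snd (snd (?xs ! Suc j))"
    by auto
  then have "evolve \<epsilon> ?xs = None"
    using assms(1) unfolding single_success_def by blast
  then show "evolve \<epsilon>' xs = None"
    using assms(2) by (simp add: evolve_Cons)
qed

text \<open>A later success would be a second one, next to the success at index 0 of the extended
  trajectory.\<close>

lemma never_success_after_success:
  assumes "single_success \<epsilon>" "transition \<epsilon> a (s, True) = Some \<epsilon>'"
  shows "never_success \<epsilon>'"
  unfolding never_success_def
proof (intro allI impI ballI notI)
  fix xs x
  assume valid: "evolve \<epsilon>' xs \<noteq> None" and x: "x \<in> set xs" "snd (snd x)"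
  then obtain i where i: "i < length xs" "xs ! i = x"
    by (auto simp: in_set_conv_nth)
  let ?xs = "(a, (s, True)) # xs"
  have "0 < length ?xs" "Suc i < length ?xs" "0 \<noteq> Suc i" "snd (snd (?xs ! 0))" "snd (snd (?xs ! Suc i))"
    using i x by auto
  then have "evolve \<epsilon> ?xs = None"
    using assms(1) unfolding single_success_def by blast
  with valid assms(2) show False
    by (simp add: evolve_Cons)
qed


section \<open>Optimality after one step\<close>

text \<open>Splicing along one pair keeps the output distribution and every transition except the
  one at \<open>(s, a)\<close>. In \<open>success_eq\<close> all terms cancel except the failure
  term at \<open>(s, a)\<close>; immediate success does not involve the successor policy.\<close>

lemma success_splice_single:
  fixes \<pi> \<sigma> :: "('s::finite, 'a::finite) policy"
  assumes "\<pi> \<in> transducers" "\<epsilon> \<in> transducers" "splice_along \<pi> [(s, a)] \<sigma> \<in> transducers"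
    and tr: "transition \<pi> s a = Some \<pi>'"
  shows "success (splice_along \<pi> [(s, a)] \<sigma>) \<epsilon> - success \<pi> \<epsilon> =
    pmf (outp \<pi>) a * pmf (outp \<epsilon>) (s, False) *
      (success \<sigma> (the (transition \<epsilon> a (s, False))) - success \<pi>' (the (transition \<epsilon> a (s, False))))"
    (is "_ = ?d")
proof -
  have "success (splice_along \<pi> [(s, a)] \<sigma>) \<epsilon> - success \<pi> \<epsilon>
      = (\<Sum>t\<in>UNIV. \<Sum>b\<in>UNIV. if t = s then if b = a then ?d else 0 else 0)"
    unfolding success_eq[OF assms(1,2)] success_eq[OF assms(3,2)] sum_subtractf[symmetric]
    using tr by (intro sum.cong refl) (auto simp: right_diff_distrib)
  also have "\<dots> = (\<Sum>t\<in>UNIV. if t = s then \<Sum>b\<in>UNIV. if b = a then ?d else 0 else 0)"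
    by (intro sum.cong) auto
  also have "\<dots> = ?d"
    by simp
  finally show ?thesis .
qed

text \<open>The mixture is indexed by the success flag. The Bernoulli formula is dropped here; what
  is kept is that a flag of positive weight can occur together with \<open>s\<close>.\<close>

lemma ambivalent_step_eq_SomeD:
  assumes "ambivalent_step \<epsilon> a s = Some \<epsilon>'"
  obtains \<alpha> where
    "\<epsilon>' = mixture \<alpha> (\<lambda>g. the (transition \<epsilon> a (s, g)))"
    "\<And>g. g \<in> set_pmf \<alpha> \<Longrightarrow> (s, g) \<in> set_pmf (outp \<epsilon>)"
proof -
  let ?f = "pmf (outp \<epsilon>) (s, False)" and ?t = "pmf (outp \<epsilon>) (s, True)"
  have q: "?f + ?t > 0"
    and \<epsilon>': "\<epsilon>' = mixture (bernoulli_pmf (?t / (?f + ?t))) (\<lambda>g. the (transition \<epsilon> a (s, g)))"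
    using assms by (auto simp: ambivalent_step_def Let_def split: if_splits)
  \<comment> \<open>The Bernoulli weights are the intended quotients only for a parameter in the
    unit interval.\<close>
  have p: "?t / (?f + ?t) \<in> {0..1}"
    using q by simp
  have "(s, g) \<in> set_pmf (outp \<epsilon>)" if "g \<in> set_pmf (bernoulli_pmf (?t / (?f + ?t)))" for g
    using that p q by (cases g) (auto simp: set_pmf_iff)
  with \<epsilon>' show thesis
    by (rule that)
qed

text \<open>Both properties pass to the branches of positive weight and from there to their
  mixture.\<close>

lemma ambivalent_step_invariant:
  assumes "\<epsilon> \<in> transducers" "single_success \<epsilon>" "ambivalent_step \<epsilon> a s = Some \<epsilon>'"
  shows "\<epsilon>' \<in> transducers" "single_success \<epsilon>'"
proof -
  obtain \<alpha> where \<epsilon>': "\<epsilon>' = mixture \<alpha> (\<lambda>g. the (transition \<epsilon> a (s, g)))"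
    and supp: "\<And>g. g \<in> set_pmf \<alpha> \<Longrightarrow> (s, g) \<in> set_pmf (outp \<epsilon>)"
    using assms(3) by (rule ambivalent_step_eq_SomeD) blast
  have "the (transition \<epsilon> a (s, g)) \<in> transducers" if "g \<in> set_pmf \<alpha>" for g
    using assms(1) supp[OF that] by (rule transition_in_transducers)
  moreover have "single_success (the (transition \<epsilon> a (s, g)))" if "g \<in> set_pmf \<alpha>" for g
    using assms(2) transition_eq_Some_the[OF assms(1) supp[OF that]]
    by (rule single_success_transition)
  ultimately show "\<epsilon>' \<in> transducers" "single_success \<epsilon>'"
    unfolding \<epsilon>' by (intro mixture_in_transducers single_success_mixture; blast)+
qed

lemma optimal_for_ambivalent_step:
  fixes T :: "('s::finite, 'a::finite) policy set"
  assumes T: "T \<subseteq> transducers" "splicing_closed T"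
    and \<epsilon>: "\<epsilon> \<in> transducers" "single_success \<epsilon>"
    and opt: "optimal_for T \<pi> \<epsilon>"
    and step: "ambivalent_step \<epsilon> a s = Some \<epsilon>'" "transition \<pi> s a = Some \<pi>'"
  shows "optimal_for (evolve_set T [(s, a)]) \<pi>' \<epsilon>'"
  unfolding optimal_for_def
proof (intro conjI ballI)
  have \<pi>: "\<pi> \<in> T" "\<pi> \<in> transducers"
    using opt T by (auto simp: optimal_for_def)
  show \<pi>'_in: "\<pi>' \<in> evolve_set T [(s, a)]"
    using \<pi> step(2) by (auto simp: evolve_set_def evolve_Cons_eq_Some_iff)
  obtain \<alpha> where \<epsilon>': "\<epsilon>' = mixture \<alpha> (\<lambda>g. the (transition \<epsilon> a (s, g)))"
    and supp: "\<And>g. g \<in> set_pmf \<alpha> \<Longrightarrow> (s, g) \<in> set_pmf (outp \<epsilon>)"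
    using step(1) by (rule ambivalent_step_eq_SomeD) blast
  let ?\<epsilon>f = "the (transition \<epsilon> a (s, False))"
  \<comment> \<open>The success branch contributes nothing, so policies are compared on
    \<open>\<epsilon>'\<close> through the failure branch, with a factor that does not depend on
    \<rho>.\<close>
  have eq: "success \<rho> \<epsilon>' = pmf \<alpha> False * success \<rho> ?\<epsilon>f" if "\<rho> \<in> transducers" for \<rho>
  proof -
    have "pmf \<alpha> True * success \<rho> (the (transition \<epsilon> a (s, True))) = 0"
    proof (cases "True \<in> set_pmf \<alpha>")
      case True
      note supp = supp[OF True]
      have "never_success (the (transition \<epsilon> a (s, True)))"
        using \<epsilon>(2) transition_eq_Some_the[OF \<epsilon>(1) supp] by (rule never_success_after_success)
      then show ?thesis
        using transition_in_transducers[OF \<epsilon>(1) supp] by (simp add: success_never_success)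
    qed (simp add: set_pmf_iff)
    moreover have "success \<rho> \<epsilon>' =
        (\<Sum>g\<in>UNIV. pmf \<alpha> g * success \<rho> (the (transition \<epsilon> a (s, g))))"
      unfolding \<epsilon>' using that supp \<epsilon>(1)
      by (intro success_mixture transition_in_transducers) auto
    ultimately show ?thesis
      by (simp add: UNIV_bool)
  qed
  fix \<sigma>'
  assume \<sigma>'_in: "\<sigma>' \<in> evolve_set T [(s, a)]"
  then obtain \<sigma> where \<sigma>: "\<sigma> \<in> T" "evolve \<sigma> [(s, a)] = Some \<sigma>'"
    by (auto simp: evolve_set_def)
  let ?\<rho> = "splice_along \<pi> [(s, a)] \<sigma>'"
  have "evolve \<pi> [(s, a)] \<noteq> None"
    using step(2) by (simp add: evolve_Cons)
  \<comment> \<open>Splicing closure is applied to \<pi> and \<sigma> along the single pair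
    \<open>(s, a)\<close>, where the evolution of \<sigma> is \<open>\<sigma>'\<close>.\<close>
  then have \<rho>: "?\<rho> \<in> T"
    using T(2) \<pi>(1) \<sigma> unfolding splicing_closed_def by (metis option.distinct(1) option.sel)
  then have "success ?\<rho> \<epsilon> \<le> success \<pi> \<epsilon>"
    using opt by (simp add: optimal_for_def)
  then have le: "pmf (outp \<pi>) a * pmf (outp \<epsilon>) (s, False) *
      (success \<sigma>' ?\<epsilon>f - success \<pi>' ?\<epsilon>f) \<le> 0"
    using success_splice_single[OF \<pi>(2) \<epsilon>(1) _ step(2), of \<sigma>'] \<rho> T(1) by auto
  have "pmf \<alpha> False * success \<sigma>' ?\<epsilon>f \<le> pmf \<alpha> False * success \<pi>' ?\<epsilon>f"
  \<comment> \<open>If failure has positive weight, then \<open>(s, False)\<close> is a possible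
    output of \<epsilon>, and \<open>a\<close> is one of \<pi> because its transition there is
    defined; hence the coefficient in \<open>le\<close> is positive and can be divided out.
    Otherwise both sides are 0.\<close>
  proof (cases "False \<in> set_pmf \<alpha>")
    case True
    then have "pmf (outp \<epsilon>) (s, False) > 0"
      by (intro pmf_positive supp)
    moreover have "a \<in> set_pmf (outp \<pi>)"
      using step(2) transition_eq_None_iff[OF \<pi>(2), of s a] by auto
    then have "pmf (outp \<pi>) a > 0"
      by (rule pmf_positive)
    ultimately have "success \<sigma>' ?\<epsilon>f \<le> success \<pi>' ?\<epsilon>f"
      using le by (simp add: mult_le_0_iff)
    then show ?thesis
      by (simp add: mult_left_mono)
  qed (simp add: set_pmf_iff)
  then show "success \<sigma>' \<epsilon>' \<le> success \<pi>' \<epsilon>'"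
    using \<pi>'_in \<sigma>'_in evolve_set_single_subset_transducers[OF T(1)] by (simp add: eq subset_iff)
qed

text \<open>Induction along the trajectory with \<open>T\<close>, \<pi> and \<epsilon> arbitrary:
  after the first pair, the evolved set, policy and environment satisfy all hypotheses again.
  Policies read each pair with its components swapped.\<close>

lemma optimal_for_ambivalent_evolve:
  fixes T :: "('s::finite, 'a::finite) policy set"
  assumes "T \<subseteq> transducers" "splicing_closed T"
    and "\<epsilon> \<in> transducers" "single_success \<epsilon>"
    and "optimal_for T \<pi> \<epsilon>"
    and "ambivalent_evolve \<epsilon> xs = Some \<epsilon>'"
    and "evolve \<pi> (map (\<lambda>(a, s). (s, a)) xs) = Some \<pi>'"
  shows "optimal_for (evolve_set T (map (\<lambda>(a, s). (s, a)) xs)) \<pi>' \<epsilon>'"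
  using assms
proof (induction xs arbitrary: T \<pi> \<epsilon>)
  case (Cons x xs)
  obtain a s where x: "x = (a, s)" by fastforce
  obtain \<epsilon>1 where \<epsilon>1: "ambivalent_step \<epsilon> a s = Some \<epsilon>1" "ambivalent_evolve \<epsilon>1 xs = Some \<epsilon>'"
    using Cons.prems(6) by (auto simp: x ambivalent_evolve_Cons bind_eq_Some_conv)
  obtain \<pi>1 where \<pi>1: "transition \<pi> s a = Some \<pi>1"
    "evolve \<pi>1 (map (\<lambda>(a, s). (s, a)) xs) = Some \<pi>'"
    using Cons.prems(7) by (auto simp: x evolve_Cons_eq_Some_iff)
  have "optimal_for (evolve_set (evolve_set T [(s, a)]) (map (\<lambda>(a, s). (s, a)) xs)) \<pi>' \<epsilon>'"
    using Cons.prems \<epsilon>1 \<pi>1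
    by (intro Cons.IH[of _ \<epsilon>1 \<pi>1] evolve_set_single_subset_transducers
              splicing_closed_evolve_set_single optimal_for_ambivalent_step)
       (auto intro: ambivalent_step_invariant)
  then show ?case
    by (simp add: x) (subst evolve_set_Cons)
qed simp

theorem theorem5p2p6:
  fixes T :: "('s::finite, 'a::finite) policy set"
    and \<pi> \<pi>' :: "('s, 'a) policy"
    and \<epsilon> \<epsilon>' :: "('a, 's) environment"
    and acts :: "'a list" and states :: "'s list" and n :: nat
  assumes "T \<subseteq> transducers"
    and "splicing_closed T"
    and "\<epsilon> \<in> transducers"
    and "single_success \<epsilon>"
    and "\<pi> \<in> T"
    and "optimal_for T \<pi> \<epsilon>"
    and "length acts = n" and "length states = n"
    and "ambivalent_evolve \<epsilon> (zip acts states) = Some \<epsilon>'"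
    and "evolve \<pi> (zip states acts) = Some \<pi>'"
  shows "optimal_for (evolve_set T (zip states acts)) \<pi>' \<epsilon>'"
  using optimal_for_ambivalent_evolve[OF assms(1-4,6,9)] assms(10)
  by (simp flip: zip_commute[of states acts])

end
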